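(* Let $q$ be a complex number with $|q|<1$. For every $z\in\mathbb{C}$, \[ \sum_{k=0}^\infty(1-z^2q^{2k+1})\frac{(z^2q;q)_k\, q^{k^2} z^{k}}{(q;q)_k} =(-zq;q)_\infty\,(z^2q;q^2)_\infty . \]
   Context: For $|q|<1$, the $q$-shifted factorials are defined by $(a;q)_\infty=\prod_{l=0}^{\infty}(1-aq^{l})$ and $(a;q)_n=\frac{(a;q)_\infty}{(aq^n;q)_\infty}$ for integers $n$; in particular $(a;q)_k=\prod_{l=0}^{k-1}(1-aq^l)$ for nonnegative integers $k$. Also $(a;q^2)_\infty=\prod_{l=0}^\infty(1-aq^{2l})$. *)

theory Defs
  imports "HOL-Analysis.Analysis"
begin

definition qpoch_inf :: "complex \<Rightarrow> complex \<Rightarrow> complex" where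
  "qpoch_inf a q = (\<Prod>l. 1 - a * q ^ l)"

text \<open>
  For integer \<open>n\<close>, \<open>(a;q)\<^sub>n\<close> is the quotient of \<open>(a;q)\<^sub>\<infinity>\<close> by \<open>(aq\<^sup>n;q)\<^sub>\<infinity>\<close>. For \<open>n \<ge> 0\<close> this is
  the finite product below. The product is the definition here because the quotient reads
  \<open>0 / 0\<close> when \<open>aq\<^sup>m = 1\<close> for some \<open>m \<ge> n\<close>, and division by zero yields \<open>0\<close> in HOL.
\<close>

definition qpoch :: "complex \<Rightarrow> complex \<Rightarrow> nat \<Rightarrow> complex" where
  "qpoch a q k = (\<Prod>l<k. 1 - a * q ^ l)"

lemma convergent_prod_qpoch:
  fixes a q :: complex
  assumes "norm q < 1"
  shows "convergent_prod (\<lambda>l. 1 - a * q ^ l)"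
proof -
  have "summable (\<lambda>l. norm (- a * q ^ l))"
    using assms by (simp add: norm_mult norm_power summable_mult summable_geometric)
  then have "abs_convergent_prod (\<lambda>l. 1 + (- a * q ^ l))"
    by (intro summable_imp_abs_convergent_prod) simp
  then show ?thesis
    using abs_convergent_prod_imp_convergent_prod by fastforce
qed

lemma qpoch_inf_split:
  assumes "norm q < 1"
  shows "qpoch_inf a q = qpoch a q n * qpoch_inf (a * q ^ n) q"
proof -
  have "(\<lambda>l. 1 - a * q ^ n * q ^ l) has_prod qpoch_inf (a * q ^ n) q"
    unfolding qpoch_inf_def using convergent_prod_qpoch[OF assms] by (rule convergent_prod_has_prod)
  then have *: "(\<lambda>k. \<Prod>l\<le>k. 1 - a * q ^ n * q ^ l) \<longlonglongrightarrow> qpoch_inf (a * q ^ n) q"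
    by (rule has_prod_imp_tendsto)
  have "(\<lambda>l. 1 - a * q ^ l) has_prod qpoch_inf a q"
    unfolding qpoch_inf_def using convergent_prod_qpoch[OF assms] by (rule convergent_prod_has_prod)
  then have "(\<lambda>k. \<Prod>l<k. 1 - a * q ^ l) \<longlonglongrightarrow> qpoch_inf a q"
    by (rule has_prod_imp_tendsto')
  then have lim: "(\<lambda>k. \<Prod>l<Suc k + n. 1 - a * q ^ l) \<longlonglongrightarrow> qpoch_inf a q"
    by (rule filterlim_compose)
      (auto intro!: filterlim_subseq simp: strict_mono_def)
  have "(\<Prod>l<Suc k + n. 1 - a * q ^ l) = qpoch a q n * (\<Prod>l\<le>k. 1 - a * q ^ n * q ^ l)" for k
    unfolding qpoch_def
    by (induction k) (simp_all add: power_add mult_ac)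
  with lim have "(\<lambda>k. qpoch a q n * (\<Prod>l\<le>k. 1 - a * q ^ n * q ^ l)) \<longlonglongrightarrow> qpoch_inf a q"
    by simp
  from LIMSEQ_unique[OF this tendsto_mult[OF tendsto_const *]] show ?thesis .
qed

lemma qpoch_eq_quotient:
  assumes "norm q < 1" "qpoch_inf (a * q ^ n) q \<noteq> 0"
  shows "qpoch a q n = qpoch_inf a q / qpoch_inf (a * q ^ n) q"
  using qpoch_inf_split[OF assms(1), of a n] assms(2) by simp

end

theory Submission
  imports Defs
begin

text \<open>
  Write \<open>F(z)\<close> for the series. Creative telescoping produces a certificate for
  \<open>(1 - zq) (F(z) - (1 + zq) (1 - z\<^sup>2q) F(zq)) = 0\<close>. Since \<open>F\<close> is continuous, the factor \<open>1 - zq\<close> can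
  be cancelled even where it vanishes. Iterating the resulting functional equation and using
  \<open>F(zq\<^sup>n) \<longlonglongrightarrow> F(0) = 1\<close> gives the product.
\<close>

section \<open>Finite and infinite q-shifted factorials\<close>

lemma qpoch_0 [simp]: "qpoch a q 0 = 1"
  by (simp add: qpoch_def)

lemma qpoch_Suc: "qpoch a q (Suc n) = qpoch a q n * (1 - a * q ^ n)"
  by (simp add: qpoch_def)

lemma qpoch_Suc_shift: "qpoch a q (Suc n) = (1 - a) * qpoch (a * q) q n"
  unfolding qpoch_def by (subst prod.lessThan_Suc_shift) (simp add: mult.assoc)

lemma qpoch_tendsto_qpoch_inf:
  assumes "norm q < 1"
  shows "qpoch a q \<longlonglongrightarrow> qpoch_inf a q"
proof -
  have "(\<lambda>l. 1 - a * q ^ l) has_prod qpoch_inf a q"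
    unfolding qpoch_inf_def using convergent_prod_qpoch[OF assms] by (rule convergent_prod_has_prod)
  then show ?thesis
    unfolding qpoch_def [abs_def] by (rule has_prod_imp_tendsto')
qed

text \<open>The bound is uniform in \<open>k\<close> because every positive power of
  \<open>q\<close> has norm at most \<open>norm q\<close>; it keeps the factors of
  \<open>qpoch q q k\<close> away from 0.\<close>

lemma norm_one_minus_power_ge:
  fixes q :: complex
  assumes "norm q < 1"
  shows "1 - norm q \<le> norm (1 - q ^ Suc k)"
proof -
  have "norm q ^ Suc k \<le> norm q"
    using assms by (simp add: mult_left_le power_le_one)
  moreover have "norm (1::complex) - norm (q ^ Suc k) \<le> norm (1 - q ^ Suc k)"
    by (rule norm_triangle_ineq2)
  ultimately show ?thesis
    by (simp only: norm_one norm_power)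
qed

lemma one_minus_power_nonzero:
  fixes q :: complex
  assumes "norm q < 1"
  shows "1 - q ^ Suc k \<noteq> 0"
  using norm_one_minus_power_ge[OF assms, of k] assms by auto

lemma qpoch_self_nonzero:
  assumes "norm q < 1"
  shows "qpoch q q k \<noteq> 0"
  unfolding qpoch_def using one_minus_power_nonzero[OF assms] by simp

section \<open>Summands and the telescoping certificate\<close>

definition hsum_term :: "complex \<Rightarrow> complex \<Rightarrow> nat \<Rightarrow> complex" where
  "hsum_term q z k = qpoch (z ^ 2 * q) q k * q ^ (k ^ 2) * z ^ k / qpoch q q k"

text \<open>With \<open>a = z^2 * q\<close>, the prefactor is the very-well-poised factor
  \<open>1 - a * q ^ (2 * k)\<close>. It is split off because \<open>hsum_term\<close> alone has a
  simple term ratio.\<close>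

definition wp_term :: "complex \<Rightarrow> complex \<Rightarrow> nat \<Rightarrow> complex" where
  "wp_term q z k = (1 - z ^ 2 * q ^ (2 * k + 1)) * hsum_term q z k"

definition wp_series :: "complex \<Rightarrow> complex \<Rightarrow> complex" where
  "wp_series q z = (\<Sum>k. wp_term q z k)"

lemma hsum_term_Suc:
  assumes "norm q < 1"
  shows "hsum_term q z (Suc k) * (1 - q ^ Suc k) =
           hsum_term q z k * (1 - z ^ 2 * q * q ^ k) * (q * (q ^ k) ^ 2 * z)"
proof -
  have "q ^ ((Suc k) ^ 2) = q ^ (k ^ 2) * (q * (q ^ k) ^ 2)"
    by (simp add: power2_eq_square power_add)
  then show ?thesis
    using one_minus_power_nonzero[OF assms, of k] qpoch_self_nonzero[OF assms, of k]
    by (simp add: hsum_term_def qpoch_Suc field_simps)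
qed

text \<open>The two prefactors extend the shifted factorial starting at \<open>z^2 * q^3\<close>
  down to \<open>z^2 * q\<close>, giving \<open>k + 2\<close> factors, of which the last two split
  off. The product form avoids dividing by prefactors that may vanish.\<close>

lemma hsum_term_shift:
  "(1 - z ^ 2 * q) * (1 - z ^ 2 * q ^ 2) * hsum_term q (z * q) k =
     hsum_term q z k * q ^ k * (1 - z ^ 2 * q * q ^ k) * (1 - z ^ 2 * q ^ 2 * q ^ k)"
proof -
  have "(1 - z ^ 2 * q) * (1 - z ^ 2 * q ^ 2) * qpoch ((z * q) ^ 2 * q) q k =
          qpoch (z ^ 2 * q) q (Suc (Suc k))"
    by (simp only: qpoch_Suc_shift) (simp add: power2_eq_square mult_ac)
  also have "\<dots> = qpoch (z ^ 2 * q) q k * (1 - z ^ 2 * q * q ^ k) * (1 - z ^ 2 * q ^ 2 * q ^ k)"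
    by (simp add: qpoch_Suc power2_eq_square mult_ac)
  finally have shift: "(1 - z ^ 2 * q) * (1 - z ^ 2 * q ^ 2) * qpoch ((z * q) ^ 2 * q) q k = \<dots>" .
  have "(1 - z ^ 2 * q) * (1 - z ^ 2 * q ^ 2) * hsum_term q (z * q) k =
          ((1 - z ^ 2 * q) * (1 - z ^ 2 * q ^ 2) * qpoch ((z * q) ^ 2 * q) q k) *
          (q ^ (k ^ 2) * (z * q) ^ k / qpoch q q k)"
    by (simp only: hsum_term_def times_divide_eq_right mult.assoc)
  then show ?thesis
    unfolding shift by (simp add: hsum_term_def power_mult_distrib mult_ac)
qed

text \<open>The factor \<open>1 - q ^ k\<close> makes the certificate vanish at \<open>k = 0\<close>
  and, at \<open>Suc k\<close>, cancels the denominator of the term ratio. The last factor is the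
  polynomial in \<open>q ^ k\<close> that makes \<open>certificate_telescopes\<close> an
  identity.\<close>

definition certificate :: "complex \<Rightarrow> complex \<Rightarrow> nat \<Rightarrow> complex" where
  "certificate q z k =
     hsum_term q z k * (1 - q ^ k) * ((1 - z * q) - z * q * q ^ k + z ^ 3 * q ^ 2 * (q ^ k) ^ 2)"

lemma certificate_telescopes:
  assumes "norm q < 1"
  shows "(1 - z * q) * (wp_term q z k - (1 + z * q) * (1 - z ^ 2 * q) * wp_term q (z * q) k) =
           certificate q z k - certificate q z (Suc k)"
proof -
  define Q where "Q = q ^ k"
  define u where "u = hsum_term q z k"
  have pow: "q ^ (2 * k + 1) = q * Q ^ 2"
    by (simp add: Q_def power_mult[symmetric] mult.commute)
  have wp: "wp_term q z k = (1 - z ^ 2 * q * Q ^ 2) * u"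
    by (simp only: wp_term_def u_def pow mult.assoc)
  \<comment> \<open>Since \<open>(1 - z * q) * (1 + z * q) = 1 - z^2 * q^2\<close>, the multiplier
    \<open>1 - z * q\<close> supplies the second prefactor that \<open>hsum_term_shift\<close>
    needs.\<close>
  have "(1 - z * q) * ((1 + z * q) * (1 - z ^ 2 * q) * wp_term q (z * q) k) =
          (1 - z ^ 2 * q ^ 3 * Q ^ 2) *
          ((1 - z ^ 2 * q) * (1 - z ^ 2 * q ^ 2) * hsum_term q (z * q) k)"
    unfolding wp_term_def pow by algebra
  also have "\<dots> = (1 - z ^ 2 * q ^ 3 * Q ^ 2) *
                 (u * Q * (1 - z ^ 2 * q * Q) * (1 - z ^ 2 * q ^ 2 * Q))"
    by (simp add: hsum_term_shift u_def Q_def)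
  finally have shifted: "(1 - z * q) * ((1 + z * q) * (1 - z ^ 2 * q) * wp_term q (z * q) k) = \<dots>" .
  have "certificate q z (Suc k) =
          (hsum_term q z (Suc k) * (1 - q ^ Suc k)) *
          ((1 - z * q) - z * q * (q * Q) + z ^ 3 * q ^ 2 * (q * Q) ^ 2)"
    by (simp add: certificate_def Q_def)
  also have "\<dots> = (u * (1 - z ^ 2 * q * Q) * (q * Q ^ 2 * z)) *
                 ((1 - z * q) - z * q * (q * Q) + z ^ 3 * q ^ 2 * (q * Q) ^ 2)"
    by (simp only: hsum_term_Suc[OF assms] u_def Q_def)
  finally have next_cert: "certificate q z (Suc k) = \<dots>" .
  have cert: "certificate q z k =
      u * (1 - Q) * ((1 - z * q) - z * q * Q + z ^ 3 * q ^ 2 * Q ^ 2)"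
    by (simp add: certificate_def u_def Q_def)
  have "(1 - z * q) * (wp_term q z k - (1 + z * q) * (1 - z ^ 2 * q) * wp_term q (z * q) k) =
          (1 - z * q) * wp_term q z k -
          (1 - z * q) * ((1 + z * q) * (1 - z ^ 2 * q) * wp_term q (z * q) k)"
    by (rule right_diff_distrib)
  \<comment> \<open>Every term is now \<open>u\<close> times a polynomial in \<open>z\<close>,
    \<open>q\<close> and \<open>Q\<close>, so a polynomial identity remains.\<close>
  then show ?thesis
    unfolding shifted next_cert cert wp by algebra
qed

section \<open>Majorant, convergence and continuity of the series\<close>

lemma summable_power_mult_power_square:
  fixes B r :: real
  assumes "0 \<le> r" "r < 1"
  shows "summable (\<lambda>k. B ^ k * r ^ (k ^ 2))"
proof -
  \<comment> \<open>This is the ratio of consecutive absolute values,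
    \<open>\<bar>B\<bar> * r ^ (2 * k + 1)\<close>; it tends to 0 however large \<open>B\<close>
    is.\<close>
  have "(\<lambda>k. \<bar>B\<bar> * r * (r ^ k * r ^ k)) \<longlonglongrightarrow> \<bar>B\<bar> * r * (0 * 0)"
    using assms by (intro tendsto_intros LIMSEQ_power_zero) auto
  then have "eventually (\<lambda>k. \<bar>B\<bar> * r * (r ^ k * r ^ k) < 1 / 2) sequentially"
    by (rule order_tendstoD(2)) simp
  then obtain N where N: "\<And>k. k \<ge> N \<Longrightarrow> \<bar>B\<bar> * r * (r ^ k * r ^ k) < 1 / 2"
    by (auto simp: eventually_sequentially)
  show ?thesis
  proof (rule summable_ratio_test[of "1 / 2" N])
    fix k assume "N \<le> k"
    have "norm (B ^ Suc k * r ^ ((Suc k) ^ 2)) =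
            (\<bar>B\<bar> * r * (r ^ k * r ^ k)) * norm (B ^ k * r ^ (k ^ 2))"
      using assms by (simp add: abs_mult power_abs power2_eq_square power_add)
    also have "\<dots> \<le> 1 / 2 * norm (B ^ k * r ^ (k ^ 2))"
      using N[OF \<open>N \<le> k\<close>] by (intro mult_right_mono) auto
    finally show "norm (B ^ Suc k * r ^ ((Suc k) ^ 2)) \<le> 1 / 2 * norm (B ^ k * r ^ (k ^ 2))" .
  qed simp
qed

text \<open>Depends on \<open>z\<close> only through a bound \<open>M\<close> on its norm, as
  uniform convergence on discs requires. The base collects, per index, one numerator factor, one
  factor \<open>z\<close> and one denominator factor.\<close>

definition majorant :: "complex \<Rightarrow> real \<Rightarrow> nat \<Rightarrow> real" where
  "majorant q M k = ((1 + M ^ 2) * M / (1 - norm q)) ^ k * norm q ^ (k ^ 2)"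

lemma summable_majorant: "norm q < 1 \<Longrightarrow> summable (majorant q M)"
  unfolding majorant_def [abs_def] by (rule summable_power_mult_power_square) auto

lemma norm_one_minus_square_mult_power_le:
  fixes q z :: complex
  assumes "norm q < 1" "norm z \<le> M"
  shows "norm (1 - z ^ 2 * q ^ n) \<le> 1 + M ^ 2"
proof -
  have "norm (1 - z ^ 2 * q ^ n) \<le> 1 + norm z ^ 2 * norm q ^ n"
    by (rule order_trans[OF norm_triangle_ineq4]) (simp add: norm_mult norm_power)
  also have "norm z ^ 2 * norm q ^ n \<le> M ^ 2 * 1"
    using assms by (intro mult_mono power_mono power_le_one) auto
  finally show ?thesis by simp
qed

lemma norm_hsum_term_le:
  assumes "norm q < 1" "norm z \<le> M"
  shows "norm (hsum_term q z k) \<le> majorant q M k"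
proof -
  have "norm (qpoch (z ^ 2 * q) q k) \<le> (\<Prod>l<k. 1 + M ^ 2)"
    unfolding qpoch_def prod_norm [symmetric]
    using norm_one_minus_square_mult_power_le[OF assms, of "Suc _"]
    by (intro prod_mono) (auto simp: mult.assoc)
  then have num: "norm (qpoch (z ^ 2 * q) q k) \<le> (1 + M ^ 2) ^ k"
    by simp
  have "(\<Prod>l<k. 1 - norm q) \<le> norm (qpoch q q k)"
    unfolding qpoch_def prod_norm [symmetric]
    using norm_one_minus_power_ge[OF assms(1)] assms(1)
    by (intro prod_mono) auto
  then have den: "(1 - norm q) ^ k \<le> norm (qpoch q q k)"
    by simp
  have "0 \<le> M"
    using assms(2) norm_ge_zero order_trans by blast
  have "norm (hsum_term q z k) =
          norm (qpoch (z ^ 2 * q) q k) * norm q ^ (k ^ 2) * norm z ^ k / norm (qpoch q q k)"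
    by (simp add: hsum_term_def norm_mult norm_divide norm_power)
  also have "\<dots> \<le> (1 + M ^ 2) ^ k * norm q ^ (k ^ 2) * M ^ k / (1 - norm q) ^ k"
    using num den assms \<open>0 \<le> M\<close>
    by (intro frac_le mult_mono power_mono) auto
  also have "\<dots> = majorant q M k"
    by (simp add: majorant_def power_mult_distrib power_divide)
  finally show ?thesis .
qed

lemma norm_wp_term_le:
  assumes "norm q < 1" "norm z \<le> M"
  shows "norm (wp_term q z k) \<le> (1 + M ^ 2) * majorant q M k"
  unfolding wp_term_def norm_mult
  by (intro mult_mono norm_one_minus_square_mult_power_le norm_hsum_term_le assms) auto

lemma summable_wp_term:
  assumes "norm q < 1"
  shows "summable (wp_term q z)"
  using summable_mult[OF summable_majorant[OF assms]] norm_wp_term_le[OF assms order_refl]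
  by (rule summable_comparison_test'[where N = 0])

text \<open>The majorant gives uniform convergence on discs, and the partial sums are polynomials in
  the variable.\<close>

lemma isCont_wp_series:
  assumes "norm q < 1"
  shows "isCont (wp_series q) z"
proof -
  \<comment> \<open>A radius exceeding \<open>norm z\<close> places \<open>z\<close> in the interior
    of the disc.\<close>
  define M where "M = norm z + 1"
  have "uniform_limit (cball 0 M) (\<lambda>n w. \<Sum>k<n. wp_term q w k) (\<lambda>w. \<Sum>k. wp_term q w k) sequentially"
    using norm_wp_term_le[OF assms] summable_mult[OF summable_majorant[OF assms]]
    by (intro Weierstrass_m_test) auto
  then have "continuous_on (cball 0 M) (wp_series q)"
    unfolding wp_series_def [abs_def]
    by (rule uniform_limit_theorem[rotated])
       (auto simp: wp_term_def hsum_term_def qpoch_def qpoch_self_nonzero[OF assms, unfolded qpoch_def]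
             intro!: always_eventually continuous_intros)
  moreover have "z \<in> interior (cball 0 M)"
    by (simp add: M_def)
  ultimately show ?thesis
    by (rule continuous_on_interior)
qed

section \<open>The functional equation\<close>

lemma certificate_tendsto_0:
  assumes "norm q < 1"
  shows "certificate q z \<longlonglongrightarrow> 0"
proof -
  have u: "hsum_term q z \<longlonglongrightarrow> 0"
    by (rule Lim_null_comparison[OF _ summable_LIMSEQ_zero[OF summable_majorant[OF assms, of "norm z"]]])
       (use norm_hsum_term_le[OF assms order_refl] in simp)
  have p: "(\<lambda>k. q ^ k) \<longlonglongrightarrow> 0"
    using assms by (rule LIMSEQ_power_zero)
  have "certificate q z \<longlonglongrightarrow>
          0 * (1 - 0) * ((1 - z * q) - z * q * 0 + z ^ 3 * q ^ 2 * 0 ^ 2)"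
    unfolding certificate_def [abs_def] by (intro tendsto_intros u p)
  then show ?thesis by simp
qed

lemma wp_series_functional_equation_mult:
  assumes "norm q < 1"
  shows "(1 - z * q) * (wp_series q z - (1 + z * q) * (1 - z ^ 2 * q) * wp_series q (z * q)) = 0"
proof -
  have wp: "wp_term q w sums wp_series q w" for w
    unfolding wp_series_def using summable_wp_term[OF assms] by (rule summable_sums)
  have "(\<lambda>k. certificate q z k - certificate q z (Suc k)) sums
          ((1 - z * q) * (wp_series q z - (1 + z * q) * (1 - z ^ 2 * q) * wp_series q (z * q)))"
    unfolding certificate_telescopes[OF assms, symmetric]
    by (intro sums_mult sums_diff wp)
  \<comment> \<open>Both boundary contributions vanish: the limit by
    \<open>certificate_tendsto_0\<close>, the initial value by its factor
    \<open>1 - q ^ 0\<close>.\<close>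
  moreover have "(\<lambda>k. certificate q z k - certificate q z (Suc k)) sums (certificate q z 0 - 0)"
    by (rule telescope_sums'[OF certificate_tendsto_0[OF assms]])
  ultimately show ?thesis
    using sums_unique2 by (fastforce simp: certificate_def)
qed

lemma wp_series_functional_equation:
  assumes "norm q < 1"
  shows "wp_series q z = (1 + z * q) * (1 - z ^ 2 * q) * wp_series q (z * q)"
proof -
  define H where "H w = wp_series q w - (1 + w * q) * (1 - w ^ 2 * q) * wp_series q (w * q)" for w
  have H0: "H w = 0" if "w * q \<noteq> 1" for w
    using wp_series_functional_equation_mult[OF assms, of w] that by (simp add: H_def)
  have "H z = 0"
  proof (cases "z * q = 1")
    case True
    have "isCont H z"
      unfolding H_def [abs_def]
      by (intro continuous_intros isCont_wp_series[OF assms] isCont_o2[OF _ isCont_wp_series[OF assms]])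
    then have "(H \<longlongrightarrow> H z) (at z)"
      by (simp add: isCont_def)
    \<comment> \<open>From \<open>z * q = 1\<close> it follows that \<open>q\<close> is nonzero, so
      \<open>w * q = 1\<close> only for \<open>w = z\<close> and \<open>H0\<close> covers every
      other point.\<close>
    moreover have "eventually (\<lambda>w. H w = 0) (at z)"
      unfolding eventually_at_filter
      by (rule always_eventually) (use H0 True in \<open>metis mult_cancel_right mult_zero_right zero_neq_one\<close>)
    then have "(H \<longlongrightarrow> 0) (at z)"
      by (rule tendsto_eventually)
    ultimately show ?thesis
      by (rule tendsto_unique[OF at_neq_bot])
  qed (rule H0)
  then show ?thesis by (simp add: H_def)
qed

section \<open>Iteration and passage to the limit\<close>

lemma wp_series_iterate:
  assumes "norm q < 1"
  shows "wp_series q z =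
           qpoch (- z * q) q n * qpoch (z ^ 2 * q) (q ^ 2) n * wp_series q (z * q ^ n)"
proof (induction n)
  case (Suc n)
  \<comment> \<open>Replacing \<open>z\<close> by \<open>z * q ^ n\<close> squares
    \<open>q ^ n\<close> in the factor \<open>1 - z^2 * q\<close>; hence the base
    \<open>q ^ 2\<close> of the second product.\<close>
  have "wp_series q (z * q ^ n) =
          (1 - (- z * q) * q ^ n) * (1 - z ^ 2 * q * (q ^ 2) ^ n) * wp_series q (z * q ^ Suc n)"
    by (subst wp_series_functional_equation[OF assms])
       (simp add: power_mult_distrib power_mult[symmetric] mult_ac)
  with Suc.IH show ?case
    by (simp only: qpoch_Suc mult_ac)
qed simp

lemma wp_series_0: "wp_series q 0 = 1"
proof -
  \<comment> \<open>The factor \<open>0 ^ k\<close> leaves only the index 0, where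
    \<open>0 ^ 0 = 1\<close>.\<close>
  have "wp_term q 0 k = 0" if "k \<notin> {0}" for k
    using that by (simp add: wp_term_def hsum_term_def)
  then have "wp_series q 0 = (\<Sum>k\<in>{0}. wp_term q 0 k)"
    unfolding wp_series_def by (intro suminf_finite) auto
  then show ?thesis
    by (simp add: wp_term_def hsum_term_def)
qed

lemma wp_series_eq:
  assumes "norm q < 1"
  shows "wp_series q z = qpoch_inf (- z * q) q * qpoch_inf (z ^ 2 * q) (q ^ 2)"
proof -
  have q2: "norm (q ^ 2) < 1"
    using assms by (simp add: norm_power power_less_one_iff)
  have "(\<lambda>n. z * q ^ n) \<longlonglongrightarrow> z * 0"
    using assms by (intro tendsto_intros LIMSEQ_power_zero)
  then have "(\<lambda>n. wp_series q (z * q ^ n)) \<longlonglongrightarrow> wp_series q (z * 0)"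
    by (rule isCont_tendsto_compose[OF isCont_wp_series[OF assms]])
  then have "(\<lambda>n. qpoch (- z * q) q n * qpoch (z ^ 2 * q) (q ^ 2) n * wp_series q (z * q ^ n))
               \<longlonglongrightarrow> qpoch_inf (- z * q) q * qpoch_inf (z ^ 2 * q) (q ^ 2) * 1"
    by (intro tendsto_mult qpoch_tendsto_qpoch_inf assms q2) (simp add: wp_series_0)
  \<comment> \<open>By \<open>wp_series_iterate\<close> the sequence on the left is constantly
    \<open>wp_series q z\<close>, so this value is its limit.\<close>
  then show ?thesis
    unfolding wp_series_iterate[OF assms, of z, symmetric] by (simp add: LIMSEQ_const_iff)
qed

theorem theorem2:
  fixes q z :: complex
  assumes "norm q < 1"
  shows "(\<lambda>k. (1 - z ^ 2 * q ^ (2 * k + 1)) * (qpoch (z ^ 2 * q) q k * q ^ (k ^ 2) * z ^ k)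
                / qpoch q q k)
         sums (qpoch_inf (- z * q) q * qpoch_inf (z ^ 2 * q) (q ^ 2))"
  using summable_sums[OF summable_wp_term[OF assms, of z]]
  unfolding wp_series_def [symmetric] wp_series_eq[OF assms]
  by (simp add: wp_term_def [abs_def] hsum_term_def)

end
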